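(* Let $m\in\mathbb{N}_0$ be odd. Then the function $\beta^{(m)}$ is star-shaped on $(0,\infty)$; that is, $$\beta^{(m)}(\alpha x)\le\alpha\,\beta^{(m)}(x)$$ for all $x\in(0,\infty)$ and all $\alpha\in(0,1]$.
   Context: Nielsen's $\beta$-function is the function $\beta:(0,\infty)\to\mathbb{R}$ defined by $\beta(x)=\int_0^1 \frac{t^{x-1}}{1+t}\,dt=\int_0^\infty\frac{e^{-xt}}{1+e^{-t}}\,dt$ for $x>0$. For $m\in\mathbb{N}_0=\{0,1,2,\dots\}$, $\beta^{(m)}$ denotes its $m$-th derivative, with $\beta^{(0)}=\beta$. *)

theory Defs
  imports "HOL-Analysis.Analysis"
begin

text \<open>
  Only the values at \<open>x > 0\<close> are meaningful; there the integrand is nonnegative and integrable,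
  so the Henstock--Kurzweil integral below agrees with the Lebesgue integral. The substitution
  \<open>t = exp (- s)\<close> turns it into the integral of \<open>exp (- x * s) / (1 + exp (- s))\<close>
  over \<open>s > 0\<close>. The value of the integrand at the single point \<open>t = 0\<close>
  (where \<open>0 powr a = 0\<close>) is irrelevant.
\<close>

definition nielsen_beta :: "real \<Rightarrow> real" where
  "nielsen_beta x = integral {0..1} (\<lambda>t. t powr (x - 1) / (1 + t))"

definition star_shaped_on :: "real set \<Rightarrow> (real \<Rightarrow> real) \<Rightarrow> bool" where
  "star_shaped_on S f \<longleftrightarrow> (\<forall>x\<in>S. \<forall>\<alpha>\<in>{0<..1}. f (\<alpha> * x) \<le> \<alpha> * f x)"

end

theory Submission
  imports Defs
begin

text \<open>
  For odd \<open>m\<close> the function \<open>f = \<beta>\<^sup>(\<^sup>m\<^sup>)\<close> is nonpositive and nondecreasing on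
  \<open>(0, \<infinity>)\<close>: under the Laplace representation of \<open>\<beta>\<close>, each derivative brings out a
  factor \<open>- t\<close>, so the sign of the derivatives alternates. Any such function is star-shaped,
  because \<open>f (\<alpha> x) \<le> f x \<le> \<alpha> f x\<close> for \<open>0 < \<alpha> \<le> 1\<close>: the first step is monotonicity
  and the second is \<open>f x \<le> 0\<close>.

  Both properties are read off from the closed form
  \<open>\<beta> x = (\<psi> ((x + 1) / 2) - \<psi> (x / 2)) / 2\<close>, which makes differentiation under the
  integral sign unnecessary: the derivatives of \<open>\<beta>\<close> become differences of polygamma values,
  and the sign of such a difference is the direction of monotonicity of the polygamma function.
  The closed form itself comes from expanding \<open>1 / (1 + t) = (1 - t) / (1 - t\<^sup>2)\<close> as a geometric
  series in \<open>t\<^sup>2\<close> and integrating term by term.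
\<close>

text \<open>
  Consecutive terms of the alternating series \<open>\<Sum>k. (-1)^k / (x + k)\<close> are grouped in pairs, so
  that each half of a pair is a term of one of two digamma series. The two series diverge, but
  their logarithmic corrections cancel.
\<close>
lemma sums_paired_reciprocals_Digamma:
  fixes x :: real
  assumes "x > 0"
  shows "(\<lambda>k. 1 / (x + 2 * real k) - 1 / (x + 2 * real k + 1)) sums
           ((Digamma ((x + 1) / 2) - Digamma (x / 2)) / 2)"
proof -
  have "(\<lambda>n. ((ln (real n) - (\<Sum>k<n. inverse ((x + 1) / 2 + real k))) -
              (ln (real n) - (\<Sum>k<n. inverse (x / 2 + real k)))) / 2)
          \<longlonglongrightarrow> (Digamma ((x + 1) / 2) - Digamma (x / 2)) / 2"
    using Digamma_LIMSEQ[of "(x + 1) / 2"] Digamma_LIMSEQ[of "x / 2"] assms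
    by (intro tendsto_divide tendsto_diff) auto
  also have "(\<lambda>n. ((ln (real n) - (\<Sum>k<n. inverse ((x + 1) / 2 + real k))) -
                   (ln (real n) - (\<Sum>k<n. inverse (x / 2 + real k)))) / 2)
           = (\<lambda>n. \<Sum>k<n. (inverse (x / 2 + real k) - inverse ((x + 1) / 2 + real k)) / 2)"
    by (simp add: sum_subtractf flip: sum_divide_distrib)
  also have "\<dots> = (\<lambda>n. \<Sum>k<n. 1 / (x + 2 * real k) - 1 / (x + 2 * real k + 1))"
  proof (intro ext sum.cong refl)
    fix k :: nat
    have "inverse (x / 2 + real k) = 2 * (1 / (x + 2 * real k))"
         "inverse ((x + 1) / 2 + real k) = 2 * (1 / (x + 2 * real k + 1))"
      using assms by (simp_all add: field_simps)
    then show "(inverse (x / 2 + real k) - inverse ((x + 1) / 2 + real k)) / 2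
             = 1 / (x + 2 * real k) - 1 / (x + 2 * real k + 1)"
      by simp
  qed
  finally show ?thesis
    by (simp add: sums_def)
qed

text \<open>
  Pairing the terms of the geometric series makes all summands nonnegative, so that monotone
  convergence applies. The endpoints are left out because the paired series vanishes at
  \<open>t = 1\<close> while the integrand does not.
\<close>
lemma nielsen_beta_conv_Digamma:
  assumes "x > 0"
  shows "nielsen_beta x = (Digamma ((x + 1) / 2) - Digamma (x / 2)) / 2"
proof -
  define a where "a = (\<lambda>k t. t powr (x - 1 + 2 * real k) - t powr (x + 2 * real k))"
  define F where "F = (\<lambda>n t. \<Sum>k<n. a k t)"
  define g where "g = (\<lambda>t. t powr (x - 1) / (1 + t))"
  have a_int: "(a k has_integral 1 / (x + 2 * real k) - 1 / (x + 2 * real k + 1)) {0<..<1}" for k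
  proof -
    have "((\<lambda>t. t powr (x - 1 + 2 * real k)) has_integral 1 / (x + 2 * real k)) {0..1}"
      using has_integral_powr_from_0[of "x - 1 + 2 * real k" 1] assms by simp
    moreover have "((\<lambda>t. t powr (x + 2 * real k)) has_integral 1 / (x + 2 * real k + 1)) {0..1}"
      using has_integral_powr_from_0[of "x + 2 * real k" 1] assms by simp
    ultimately have "(a k has_integral 1 / (x + 2 * real k) - 1 / (x + 2 * real k + 1)) {0..1}"
      unfolding a_def by (rule has_integral_diff)
    then show ?thesis
      by (simp add: has_integral_Icc_iff_Ioo)
  qed
  have F_int: "(F n has_integral (\<Sum>k<n. 1 / (x + 2 * real k) - 1 / (x + 2 * real k + 1)))
                 {0<..<1}" for n
    unfolding F_def by (intro has_integral_sum a_int) auto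
  have lim: "(\<lambda>n. integral {0<..<1} (F n))
               \<longlonglongrightarrow> (Digamma ((x + 1) / 2) - Digamma (x / 2)) / 2"
    using sums_paired_reciprocals_Digamma[OF assms]
    unfolding sums_def integral_unique[OF F_int] .
  have a_eq: "a k t = (t powr (x - 1) * (1 - t)) * (t\<^sup>2) ^ k" if "t \<in> {0<..<1}" for k t
  proof -
    have "t powr (x - 1 + 2 * real k) = t powr (x - 1) * (t\<^sup>2) ^ k"
      using that powr_realpow[of t "2 * k"] by (simp add: powr_add power_mult)
    moreover have "t powr (x + 2 * real k) = t * t powr (x - 1 + 2 * real k)"
      using that powr_mult_base[of t "x - 1 + 2 * real k"] by simp
    ultimately show ?thesis
      by (simp add: a_def algebra_simps)
  qed
  have "g integrable_on {0<..<1} \<and>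
        (\<lambda>n. integral {0<..<1} (F n)) \<longlonglongrightarrow> integral {0<..<1} g"
  proof (rule monotone_convergence_increasing)
    show "F n integrable_on {0<..<1}" for n
      using F_int by (rule has_integral_integrable)
    show "F n t \<le> F (Suc n) t" if "t \<in> {0<..<1}" for n t
      using that by (simp add: F_def a_eq)
    show "(\<lambda>n. F n t) \<longlonglongrightarrow> g t" if t: "t \<in> {0<..<1}" for t
    proof -
      have "norm (t\<^sup>2) < 1"
        using t by (simp add: power_less_one_iff abs_square_less_1)
      then have "(\<lambda>k. a k t) sums ((t powr (x - 1) * (1 - t)) * (1 / (1 - t\<^sup>2)))"
        unfolding a_eq[OF t] by (intro sums_mult geometric_sums)
      moreover have "1 - t\<^sup>2 = (1 - t) * (1 + t)"
        by (simp add: power2_eq_square algebra_simps)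
      then have "(t powr (x - 1) * (1 - t)) * (1 / (1 - t\<^sup>2)) = g t"
        using t by (simp add: g_def)
      ultimately show ?thesis
        by (simp add: F_def sums_def)
    qed
    show "bounded (range (\<lambda>n. integral {0<..<1} (F n)))"
      using lim by (rule convergent_imp_bounded)
  qed
  then have "integral {0<..<1} g = (Digamma ((x + 1) / 2) - Digamma (x / 2)) / 2"
    using lim LIMSEQ_unique by blast
  then show ?thesis
    by (simp add: nielsen_beta_def g_def integral_open_interval_real)
qed

lemma has_field_derivative_Polygamma_half_difference:
  fixes x :: real
  assumes "x > 0"
  shows "((\<lambda>x. (Polygamma m ((x + 1) / 2) - Polygamma m (x / 2)) / 2 ^ Suc m)
           has_field_derivative
           (Polygamma (Suc m) ((x + 1) / 2) - Polygamma (Suc m) (x / 2)) / 2 ^ Suc (Suc m)) (at x)"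
  using assms
  by (auto intro!: derivative_eq_intros elim!: nonpos_Ints_cases simp: field_simps)

lemma higher_deriv_nielsen_beta:
  assumes "x > 0"
  shows "(deriv ^^ m) nielsen_beta x
       = (Polygamma m ((x + 1) / 2) - Polygamma m (x / 2)) / 2 ^ Suc m"
  using assms
proof (induction m arbitrary: x)
  case 0
  then show ?case
    by (simp add: nielsen_beta_conv_Digamma)
next
  case (Suc m)
  have "eventually (\<lambda>y. y \<in> {0<..}) (nhds x)"
    using Suc.prems by (intro eventually_nhds_in_open) auto
  then have "eventually (\<lambda>y. (deriv ^^ m) nielsen_beta y
               = (Polygamma m ((y + 1) / 2) - Polygamma m (y / 2)) / 2 ^ Suc m) (nhds x)"
    by eventually_elim (use Suc.IH in simp)
  then have "deriv ((deriv ^^ m) nielsen_beta) x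
           = deriv (\<lambda>y. (Polygamma m ((y + 1) / 2) - Polygamma m (y / 2)) / 2 ^ Suc m) x"
    by (rule deriv_cong_ev) simp
  also have "\<dots> = (Polygamma (Suc m) ((x + 1) / 2) - Polygamma (Suc m) (x / 2)) / 2 ^ Suc (Suc m)"
    by (rule DERIV_imp_deriv[OF has_field_derivative_Polygamma_half_difference[OF Suc.prems]])
  finally show ?case
    by simp
qed

lemma higher_deriv_nielsen_beta_nonpos:
  assumes "odd m" "x > 0"
  shows "(deriv ^^ m) nielsen_beta x \<le> 0"
proof -
  have "Polygamma m ((x + 1) / 2) < Polygamma m (x / 2)"
    using assms by (intro Polygamma_real_strict_antimono) auto
  then show ?thesis
    using assms by (simp add: higher_deriv_nielsen_beta divide_nonpos_pos)
qed

lemma higher_deriv_nielsen_beta_mono: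
  assumes "odd m" "0 < x" "x \<le> y"
  shows "(deriv ^^ m) nielsen_beta x \<le> (deriv ^^ m) nielsen_beta y"
proof -
  let ?f = "\<lambda>x::real. (Polygamma m ((x + 1) / 2) - Polygamma m (x / 2)) / 2 ^ Suc m"
  have "?f x \<le> ?f y"
  proof (rule DERIV_nonneg_imp_nondecreasing[OF assms(3)])
    fix z assume "x \<le> z" "z \<le> y"
    then have z: "z > 0"
      using assms by simp
    have "Polygamma (Suc m) (z / 2) \<le> Polygamma (Suc m) ((z + 1) / 2)"
      using z assms by (intro Polygamma_real_mono) auto
    then show "\<exists>d. DERIV ?f z :> d \<and> 0 \<le> d"
      using has_field_derivative_Polygamma_half_difference[OF z, of m]
      by (intro exI conjI) auto
  qed
  then show ?thesis
    using assms by (simp add: higher_deriv_nielsen_beta)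
qed

lemma star_shaped_on_if_mono_nonpos:
  assumes mono: "\<And>x y. 0 < x \<Longrightarrow> x \<le> y \<Longrightarrow> f x \<le> f y"
    and nonpos: "\<And>x. 0 < x \<Longrightarrow> f x \<le> 0"
  shows "star_shaped_on {0<..} f"
  unfolding star_shaped_on_def
proof (intro ballI)
  fix x \<alpha> :: real
  assume "x \<in> {0<..}" "\<alpha> \<in> {0<..1}"
  then have x: "x > 0" and \<alpha>: "0 < \<alpha>" "\<alpha> \<le> 1"
    by auto
  have "f (\<alpha> * x) \<le> f x"
    using x \<alpha> by (intro mono) (auto simp: mult_le_cancel_right1)
  also have "\<dots> \<le> \<alpha> * f x"
    using nonpos[OF x] \<alpha> by (simp add: mult_le_cancel_right1)
  finally show "f (\<alpha> * x) \<le> \<alpha> * f x" .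
qed

theorem theorem2p18:
  fixes m :: nat
  assumes "odd m"
  shows "star_shaped_on {0<..} ((deriv ^^ m) nielsen_beta)"
  using assms
  by (intro star_shaped_on_if_mono_nonpos higher_deriv_nielsen_beta_mono
      higher_deriv_nielsen_beta_nonpos)

end
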